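(* Let $\Pi\in S_n$ be a permutation, let $G'=\Pi(G)$, and let $\mathcal{W}'=\{\Pi\Psi_j\Pi^T,\Pi\Phi\Pi^T\}_{j\in\mathcal{J}}$ be the corresponding transform on $G'$. Then $$\overline{\mathbf{S}}'\Pi\mathbf{x}=\overline{\mathbf{S}}\mathbf{x}\qquad\text{for all }\mathbf{x}\in\mathbf{L}^2(\mathbf{M}).$$
   Context: $G$ is a weighted connected graph with vertices $\{0,\dots,n-1\}$; $\mathbf{M}$ is an invertible real $n\times n$ matrix; $\mathbf{L}^2(\mathbf{M})$ is $\mathbb{R}^n$ with inner product $\langle\mathbf{x},\mathbf{y}\rangle_{\mathbf{M}}=\langle\mathbf{M}\mathbf{x},\mathbf{M}\mathbf{y}\rangle_2$ and norm $\|\mathbf{x}\|_{\mathbf{M}}=\|\mathbf{M}\mathbf{x}\|_2$. $\mathcal{J}$ is a countable index set and $\mathcal{W}=\{\Psi_j,\Phi\}_{j\in\mathcal{J}}$ is a family of $n\times n$ matrices that is a frame on $\mathbf{L}^2(\mathbf{M})$, i.e. for some $0<c\le C<\infty$, $c\|\mathbf{x}\|_{\mathbf{M}}^2\le\sum_{j}\|\Psi_j\mathbf{x}\|_{\mathbf{M}}^2+\|\Phi\mathbf{x}\|_{\mathbf{M}}^2\le C\|\mathbf{x}\|_{\mathbf{M}}^2$ for all $\mathbf{x}$. $\boldsymbol{\mu}\in\mathbf{L}^2(\mathbf{M})$ is a fixed weighting vector. A permutation $\Pi\in S_n$ is identified with its permutation matrix; $\Pi(G)$ is the graph obtained by permuting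 the vertices of $G$. On $G'=\Pi(G)$ one uses $\mathbf{M}'=\Pi\mathbf{M}\Pi^T$ and $\boldsymbol{\mu}'=\Pi\boldsymbol{\mu}$. Let $M$ denote the entrywise absolute value on $\mathbb{R}^n$. For a path $\mathbf{p}=(j_1,\dots,j_m)\in\mathcal{J}^m$ set $\mathbf{U}[\mathbf{p}]\mathbf{x}=M\Psi_{j_m}\cdots M\Psi_{j_1}\mathbf{x}$ (for the empty path, $m=0$, $\mathbf{U}[\mathbf{p}]\mathbf{x}=\mathbf{x}$). The non-windowed scattering transform is $\overline{\mathbf{S}}\mathbf{x}=\{\overline{\mathbf{S}}[\mathbf{p}]\mathbf{x}\}_{\mathbf{p}}$ with $\overline{\mathbf{S}}[\mathbf{p}]\mathbf{x}=\langle\boldsymbol{\mu},\mathbf{U}[\mathbf{p}]\mathbf{x}\rangle_{\mathbf{M}}$, indexed by all paths of all lengths $m\ge0$. $\overline{\mathbf{S}}'$ is defined in the same way from $\mathcal{W}'$, $\boldsymbol{\mu}'$ and $\mathbf{M}'$: $\overline{\mathbf{S}}'[\mathbf{p}]\mathbf{y}=\langle\boldsymbol{\mu}',\mathbf{U}'[\mathbf{p}]\mathbf{y}\rangle_{\mathbf{M}'}$, where $\mathbf{U}'$ is built from $\Psi_j'=\Pi\Psi_j\Pi^T$. *)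

theory Defs
  imports "HOL-Analysis.Analysis"
begin

text \<open>
  The \<open>n\<close> vertices are the elements of a finite type \<open>'n\<close>, so that signals are vectors in
  \<open>real ^ 'n\<close> and \<open>n \<times> n\<close> matrices have type \<open>real ^ 'n ^ 'n\<close>.
\<close>

section \<open>Weighted graphs\<close>

text \<open>An undirected edge between \<open>u\<close> and \<open>v\<close> is stored as both \<open>(u, v)\<close> and \<open>(v, u)\<close>; the values
  of \<open>weight\<close> on non-edges carry no meaning. Loops are not excluded.\<close>

record 'n wgraph =
  edges :: "('n \<times> 'n) set"
  weight :: "'n \<Rightarrow> 'n \<Rightarrow> real"

definition weighted_graph :: "'n wgraph \<Rightarrow> bool" where
  "weighted_graph G \<longleftrightarrow>
     sym (edges G) \<and>
     (\<forall>(u, v) \<in> edges G. weight G u v > 0 \<and> weight G u v = weight G v u)"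

definition connected_graph :: "'n wgraph \<Rightarrow> bool" where
  "connected_graph G \<longleftrightarrow> (\<forall>u v. (u, v) \<in> (edges G)\<^sup>*)"

text \<open>Vertex \<open>v\<close> of \<open>G\<close> becomes vertex \<open>\<pi> v\<close> of the permuted graph.\<close>

definition permute_graph :: "('n \<Rightarrow> 'n) \<Rightarrow> 'n wgraph \<Rightarrow> 'n wgraph" where
  "permute_graph \<pi> G =
     \<lparr> edges = {(\<pi> u, \<pi> v) | u v. (u, v) \<in> edges G},
       weight = (\<lambda>u v. weight G (inv \<pi> u) (inv \<pi> v)) \<rparr>"

text \<open>The convention is the one compatible with \<^const>\<open>permute_graph\<close>: the matrix sends the unit
  vector at \<open>v\<close> to the unit vector at \<open>\<pi> v\<close>.\<close>

definition perm_matrix :: "('n::finite \<Rightarrow> 'n) \<Rightarrow> real ^ 'n ^ 'n" where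
  "perm_matrix \<pi> = (\<chi> i j. if i = \<pi> j then 1 else 0)"

section \<open>The weighted space \<open>L\<^sup>2(M)\<close> and frames\<close>

definition inner_M :: "real ^ 'n ^ 'n \<Rightarrow> real ^ 'n \<Rightarrow> real ^ 'n \<Rightarrow> real" where
  "inner_M M x y = (M *v x) \<bullet> (M *v y)"

definition norm_M :: "real ^ 'n ^ 'n \<Rightarrow> real ^ 'n \<Rightarrow> real" where
  "norm_M M x = norm (M *v x)"

text \<open>Summability is required explicitly because \<^const>\<open>infsum\<close> is \<open>0\<close> on non-summable families,
  whereas the upper frame bound asserts that the sum is finite.\<close>

definition is_frame ::
  "real ^ 'n ^ 'n \<Rightarrow> 'j set \<Rightarrow> ('j \<Rightarrow> real ^ 'n ^ 'n) \<Rightarrow> real ^ 'n ^ 'n \<Rightarrow> bool" where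
  "is_frame M J \<Psi> \<Phi> \<longleftrightarrow>
     (\<exists>c C. 0 < c \<and> c \<le> C \<and>
        (\<forall>x. (\<lambda>j. (norm_M M (\<Psi> j *v x))\<^sup>2) summable_on J \<and>
             c * (norm_M M x)\<^sup>2
               \<le> (\<Sum>\<^sub>\<infinity>j\<in>J. (norm_M M (\<Psi> j *v x))\<^sup>2) + (norm_M M (\<Phi> *v x))\<^sup>2 \<and>
             (\<Sum>\<^sub>\<infinity>j\<in>J. (norm_M M (\<Psi> j *v x))\<^sup>2) + (norm_M M (\<Phi> *v x))\<^sup>2
               \<le> C * (norm_M M x)\<^sup>2))"

section \<open>The non-windowed scattering transform\<close>

definition abs_vec :: "real ^ 'n \<Rightarrow> real ^ 'n" where
  "abs_vec x = (\<chi> i. \<bar>x $ i\<bar>)"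

text \<open>The path \<open>(j\<^sub>1, \<dots>, j\<^sub>m)\<close> is the list with head \<open>j\<^sub>1\<close>, whose matrix is applied first.\<close>

fun scatter_U :: "('j \<Rightarrow> real ^ 'n ^ 'n) \<Rightarrow> 'j list \<Rightarrow> real ^ 'n \<Rightarrow> real ^ 'n" where
  "scatter_U \<Psi> [] x = x"
| "scatter_U \<Psi> (j # p) x = scatter_U \<Psi> p (abs_vec (\<Psi> j *v x))"

text \<open>The transform is a family indexed by the paths with entries in \<open>J\<close>, i.e. by \<open>lists J\<close>;
  \<^const>\<open>restrict\<close> makes equality of transforms mean equality on exactly these paths.\<close>

definition scatter_nonwindowed ::
  "real ^ 'n ^ 'n \<Rightarrow> real ^ 'n \<Rightarrow> 'j set \<Rightarrow> ('j \<Rightarrow> real ^ 'n ^ 'n) \<Rightarrow> real ^ 'n \<Rightarrow> 'j list \<Rightarrow> real"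
  where
  "scatter_nonwindowed M \<mu> J \<Psi> x = restrict (\<lambda>p. inner_M M \<mu> (scatter_U \<Psi> p x)) (lists J)"

end

theory Submission
  imports Defs
begin

text \<open>A permutation matrix is orthogonal, so conjugating by it intertwines the filters and preserves
  the inner product; it also commutes with the entrywise absolute value. Hence
  \<open>U'[p] (P x) = P (U[p] x)\<close> for every path \<open>p\<close>, and the outer inner product removes \<open>P\<close>.\<close>

lemma perm_matrix_mult_nth:
  assumes "\<pi> permutes UNIV"
  shows "(perm_matrix \<pi> *v x) $ i = x $ inv \<pi> i"
proof -
  have "(perm_matrix \<pi> *v x) $ i = (\<Sum>j\<in>UNIV. if j = inv \<pi> i then x $ j else 0)"
    unfolding perm_matrix_def matrix_vector_mult_def vec_lambda_beta
    by (intro sum.cong refl) (auto simp: permutes_inverses[OF assms])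
  then show ?thesis by simp
qed

text \<open>The columns are unit vectors, pairwise distinct because \<open>\<pi>\<close> is
  injective. For a square matrix \<open>transpose P ** P = mat 1\<close> suffices.\<close>

lemma orthogonal_perm_matrix:
  assumes "\<pi> permutes UNIV"
  shows "orthogonal_matrix (perm_matrix \<pi>)"
proof -
  have "(transpose (perm_matrix \<pi>) ** perm_matrix \<pi>) $ i $ j = mat 1 $ i $ j" for i j
    using permutes_inj[OF assms]
    by (simp add: matrix_matrix_mult_def transpose_def perm_matrix_def mat_def inj_eq
        if_distrib[where f = "\<lambda>u. u * _"] cong: if_cong)
  then show ?thesis
    by (simp add: orthogonal_matrix vec_eq_iff)
qed

text \<open>The matrix only relocates coordinates; a general orthogonal matrix need not commute with
  \<open>abs_vec\<close>.\<close>

lemma abs_vec_perm_matrix: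
  assumes "\<pi> permutes UNIV"
  shows "abs_vec (perm_matrix \<pi> *v x) = perm_matrix \<pi> *v abs_vec x"
  by (simp add: vec_eq_iff abs_vec_def perm_matrix_mult_nth[OF assms])

lemma conj_orthogonal_mult_vec:
  fixes P A :: "real ^ 'n ^ 'n"
  assumes "orthogonal_matrix P"
  shows "(P ** A ** transpose P) *v (P *v x) = P *v (A *v x)"
proof -
  \<comment> \<open>Reassociation isolates \<open>transpose P ** P\<close>, which orthogonality
    turns into the identity.\<close>
  have "(P ** A ** transpose P) *v (P *v x) = P *v (A *v ((transpose P ** P) *v x))"
    by (simp only: matrix_vector_mul_assoc matrix_mul_assoc)
  then show ?thesis
    using assms by (simp add: orthogonal_matrix)
qed

lemma inner_M_conj_orthogonal:
  assumes "orthogonal_matrix P"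
  shows "inner_M (P ** M ** transpose P) (P *v x) (P *v y) = inner_M M x y"
proof -
  have "orthogonal_transformation ((*v) P)"
    using assms by (simp add: orthogonal_transformation_matrix)
  then show ?thesis
    by (simp add: inner_M_def conj_orthogonal_mult_vec[OF assms] orthogonal_transformation_def)
qed

lemma scatter_U_perm_matrix:
  assumes "\<pi> permutes UNIV" and "p \<in> lists J"
    and "\<And>j. j \<in> J \<Longrightarrow> \<Psi>' j = perm_matrix \<pi> ** \<Psi> j ** transpose (perm_matrix \<pi>)"
  shows "scatter_U \<Psi>' p (perm_matrix \<pi> *v x) = perm_matrix \<pi> *v scatter_U \<Psi> p x"
  using assms(2)
  \<comment> \<open>The signal must stay general: the recursion passes
    \<open>abs_vec (\<Psi> j *v x)\<close> on to the rest of the path.\<close>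
  by (induction p arbitrary: x)
    (simp_all add: assms(3) abs_vec_perm_matrix[OF assms(1)]
      conj_orthogonal_mult_vec[OF orthogonal_perm_matrix[OF assms(1)]])

theorem theorem3p7:
  fixes G G' :: "'n::finite wgraph"
    and M M' :: "real ^ 'n ^ 'n"
    and J :: "'j set"
    and \<Psi> \<Psi>' :: "'j \<Rightarrow> real ^ 'n ^ 'n"
    and \<Phi> \<Phi>' :: "real ^ 'n ^ 'n"
    and \<mu> \<mu>' :: "real ^ 'n"
    and \<pi> :: "'n \<Rightarrow> 'n"
    and P :: "real ^ 'n ^ 'n"
  assumes "weighted_graph G" and "connected_graph G"
    and "invertible M"
    and "countable J"
    and "is_frame M J \<Psi> \<Phi>"
    and "\<pi> permutes UNIV"
    and "P = perm_matrix \<pi>"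
    and "G' = permute_graph \<pi> G"
    and "M' = P ** M ** transpose P"
    and "\<mu>' = P *v \<mu>"
    and "\<And>j. j \<in> J \<Longrightarrow> \<Psi>' j = P ** \<Psi> j ** transpose P"
    and "\<Phi>' = P ** \<Phi> ** transpose P"
  shows "\<forall>x :: real ^ 'n.
           scatter_nonwindowed M' \<mu>' J \<Psi>' (P *v x) = scatter_nonwindowed M \<mu> J \<Psi> x"
  unfolding assms(7,9,10) scatter_nonwindowed_def
\<comment> \<open>Off \<open>lists J\<close> both families are \<open>undefined\<close>, so only
  paths with entries in \<open>J\<close> remain, where \<open>\<Psi>'\<close> is given by
  conjugation.\<close>
proof (intro allI restrict_ext)
  fix x :: "real ^ 'n" and p assume "p \<in> lists J"
  then have "scatter_U \<Psi>' p (perm_matrix \<pi> *v x) = perm_matrix \<pi> *v scatter_U \<Psi> p x"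
    using assms(6,7,11) by (intro scatter_U_perm_matrix) auto
  then show "inner_M (perm_matrix \<pi> ** M ** transpose (perm_matrix \<pi>)) (perm_matrix \<pi> *v \<mu>)
      (scatter_U \<Psi>' p (perm_matrix \<pi> *v x)) = inner_M M \<mu> (scatter_U \<Psi> p x)"
    by (simp add: inner_M_conj_orthogonal orthogonal_perm_matrix[OF assms(6)])
qed

end
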